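(* Let $\widehat\alpha_k=q^{6r^2-r}-q^{6r^2-2r}$ if $k=3r-1$, $\widehat\alpha_k=q^{6r^2+2r}$ if $k=3r$, $\widehat\alpha_k=-q^{6r^2+7r+2}$ if $k=3r+1$. Then for every integer $p\ge1$, every positive integer $N$ and every primitive $N$th root of unity $q$, $$-\frac12+H_p^{(10)}(q)=q^p\left(\sum_{k=0}^{N-2}(-1)^kq^{-\binom{k+1}{2}+p(k^2+2k)}\widehat\alpha_k+\frac12q^{-p}\widehat\alpha_{N-1}\right).$$
   Context: $(a)_n=\prod_{k=1}^n(1-aq^{k-1})$, $\begin{bmatrix} n\\ k\end{bmatrix}=\frac{(q)_n}{(q)_{n-k}(q)_k}$. $H_p^{(10)}(q)=\sum_{n_p\ge\cdots\ge n_1\ge0}q^{-n_p^2}(q^{n_p})_{n_p}\prod_{i=1}^{p-1}q^{n_i^2}\begin{bmatrix} n_{i+1}\\ n_i\end{bmatrix}$; at a root of unity only finitely many terms are nonzero. (In the paper $\widehat\alpha_k=\frac{1-q}{1-q^{k+1}}\alpha_k$ where $\alpha_k=\frac{1-q^{k+1}}{1-q}\widehat\alpha_k$ is part of a Bailey pair relative to $q^2$.) *)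

theory Defs
  imports "HOL-Analysis.Analysis"
begin

definition primitive_root_of_unity :: "nat \<Rightarrow> complex \<Rightarrow> bool" where
  "primitive_root_of_unity N q \<longleftrightarrow> N > 0 \<and> q ^ N = 1 \<and> (\<forall>m. 0 < m \<and> m < N \<longrightarrow> q ^ m \<noteq> 1)"

text \<open>The \<open>q\<close>-shifted factorial \<open>(a)\<^sub>n = (a; q)\<^sub>n\<close>; the base \<open>q\<close> comes first.
  In particular \<open>(q)\<^sub>n\<close> is \<open>qpoch q q n\<close>.\<close>

definition qpoch :: "complex \<Rightarrow> complex \<Rightarrow> nat \<Rightarrow> complex" where
  "qpoch q a n = (\<Prod>k=1..n. 1 - a * q ^ (k - 1))"

text \<open>A literal quotient of complex numbers. At a primitive \<open>N\<close>-th root of unity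
  this is the value of the Gaussian polynomial for \<open>k \<le> n < N\<close>, where the denominator does
  not vanish. For \<open>n \<ge> N\<close> it may be a conventional \<open>0 / 0 = 0\<close>, but in
  \<open>H10\<close> such a coefficient is always multiplied by a vanishing factor
  (see \<open>H10_summand_eq_0\<close>).\<close>

definition qbinomial :: "complex \<Rightarrow> nat \<Rightarrow> nat \<Rightarrow> complex" where
  "qbinomial q n k = qpoch q q n / (qpoch q q (n - k) * qpoch q q k)"

text \<open>The tuples \<open>n\<^sub>p \<ge> \<dots> \<ge> n\<^sub>1 \<ge> 0\<close>, as functions on the index set \<open>{1..p}\<close>
  that take a fixed dummy value outside it, so that each tuple is counted once.\<close>

definition monotone_tuples :: "nat \<Rightarrow> (nat \<Rightarrow> nat) set" where
  "monotone_tuples p = {n \<in> {1..p} \<rightarrow>\<^sub>E UNIV. \<forall>i\<in>{1..<p}. n i \<le> n (i + 1)}"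

definition H10_summand :: "nat \<Rightarrow> complex \<Rightarrow> (nat \<Rightarrow> nat) \<Rightarrow> complex" where
  "H10_summand p q n = q powi (- (int (n p))\<^sup>2) * qpoch q (q ^ n p) (n p) *
     (\<Prod>i=1..p-1. q ^ ((n i)\<^sup>2) * qbinomial q (n (i + 1)) (n i))"

text \<open>At a root of unity only finitely many summands are nonzero
  (see \<open>finite_support_H10\<close>), so the infinite sum is then a finite one.\<close>

definition H10 :: "nat \<Rightarrow> complex \<Rightarrow> complex" where
  "H10 p q = (\<Sum>\<^sub>\<infinity>n\<in>monotone_tuples p. H10_summand p q n)"

text \<open>Every \<open>k \<ge> 0\<close> is exactly one of \<open>3r - 1\<close> with \<open>r \<ge> 1\<close>, \<open>3r\<close> and \<open>3r + 1\<close> with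
  \<open>r \<ge> 0\<close>, and \<open>r\<close> is \<open>(k + 1) div 3\<close> in each case.\<close>

definition alpha_hat :: "complex \<Rightarrow> nat \<Rightarrow> complex" where
  "alpha_hat q k = (let r = int ((k + 1) div 3) in
     if k mod 3 = 2 then q powi (6 * r\<^sup>2 - r) - q powi (6 * r\<^sup>2 - 2 * r)
     else if k mod 3 = 0 then q powi (6 * r\<^sup>2 + 2 * r)
     else - (q powi (6 * r\<^sup>2 + 7 * r + 2)))"

lemma alpha_hat_3r_minus_1:
  assumes "r \<ge> 1"
  shows "alpha_hat q (3 * r - 1) = q powi (6 * (int r)\<^sup>2 - int r) - q powi (6 * (int r)\<^sup>2 - 2 * int r)"
proof -
  obtain s where s: "r = Suc s"
    using assms by (cases r) auto
  have k: "3 * r - 1 = 3 * s + 2"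
    using s by simp
  have "(3 * s + 2) mod 3 = 2" "(3 * s + 2 + 1) div 3 = r"
    unfolding s by presburger+
  then show ?thesis unfolding alpha_hat_def Let_def k by simp
qed

lemma alpha_hat_3r: "alpha_hat q (3 * r) = q powi (6 * (int r)\<^sup>2 + 2 * int r)"
proof -
  have "(3 * r) mod 3 = 0" "(3 * r + 1) div 3 = r"
    by presburger+
  then show ?thesis by (simp add: alpha_hat_def Let_def del: mod_mult_self1_is_0)
qed

lemma alpha_hat_3r_plus_1:
  "alpha_hat q (3 * r + 1) = - (q powi (6 * (int r)\<^sup>2 + 7 * int r + 2))"
proof -
  have "(3 * r + 1) mod 3 = 1" "(3 * r + 1 + 1) div 3 = r"
    by presburger+
  then show ?thesis unfolding alpha_hat_def Let_def by simp
qed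

lemma H10_summand_eq_0:
  assumes "primitive_root_of_unity N q" "n p \<ge> N"
  shows "H10_summand p q n = 0"
proof -
  define m where "m = n p"
  have N: "N > 0" "q ^ N = 1" "N \<le> m"
    using assms by (auto simp: primitive_root_of_unity_def m_def)
  define k where "k = N * ((m + N - 1) div N) - m + 1"
  have "m + N - 1 = N * ((m + N - 1) div N) + (m + N - 1) mod N" by simp
  moreover have "(m + N - 1) mod N < N" using N by simp
  ultimately have *: "N * ((m + N - 1) div N) \<ge> m" "N * ((m + N - 1) div N) \<le> m + N - 1"
    by linarith+
  then have "N * ((m + N - 1) div N) - m + 1 \<le> m"
    using N by linarith
  then have k: "k \<in> {1..m}" "m + (k - 1) = N * ((m + N - 1) div N)"
    using * unfolding k_def by simp_all
  have "q ^ m * q ^ (k - 1) = 1"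
    using N by (metis k(2) power_add power_mult power_one)
  then have "qpoch q (q ^ m) m = 0"
    using k(1) unfolding qpoch_def by (intro prod_zero) auto
  then show ?thesis by (simp add: H10_summand_def m_def)
qed

lemma finite_support_H10:
  assumes "primitive_root_of_unity N q"
  shows "finite {n \<in> monotone_tuples p. H10_summand p q n \<noteq> 0}"
proof (rule finite_subset)
  show "{n \<in> monotone_tuples p. H10_summand p q n \<noteq> 0} \<subseteq> {1..p} \<rightarrow>\<^sub>E {..<N}"
  proof
    fix n assume "n \<in> {n \<in> monotone_tuples p. H10_summand p q n \<noteq> 0}"
    then have "n \<in> monotone_tuples p" and n_p: "H10_summand p q n \<noteq> 0"
      by simp_all
    then have n: "n \<in> {1..p} \<rightarrow>\<^sub>E UNIV" "\<And>i. i \<in> {1..<p} \<Longrightarrow> n i \<le> n (i + 1)"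
      unfolding monotone_tuples_def by blast+
    have "n p < N"
      using n_p H10_summand_eq_0[OF assms, of n p] by (meson not_le)
    have "n i \<le> n p" if "1 \<le> i" "i \<le> p" for i
      using that(2,1)
    proof (induction i rule: inc_induct)
      case (step j)
      then show ?case using n(2)[of j] by simp
    qed simp
    then have "n i \<in> {..<N}" if "i \<in> {1..p}" for i
      using that \<open>n p < N\<close> by (meson atLeastAtMost_iff lessThan_iff le_less_trans)
    then show "n \<in> {1..p} \<rightarrow>\<^sub>E {..<N}"
      using n(1) by (simp add: PiE_iff)
  qed
qed (simp add: finite_PiE)

end

theory Submission
  imports Defs
begin

text \<open>The inner multisum is a \<open>p\<close>-fold Bailey chain (relative to \<open>a = 1\<close>) started at the unit
  Bailey pair, so \<open>(q\<^sup>n)\<^sub>n\<close> times it is a sum over \<open>r \<le> n\<close> of \<open>\<plusminus>q\<close> to the power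
  \<open>r(r-1)/2 + p r\<^sup>2\<close> times a combination of Gaussian binomials with upper entry \<open>2n - 1\<close>. This holds
  for \<open>|q| < 1\<close>, where no denominator vanishes, and extends to roots of unity by continuity.
  Interchanging the sums over \<open>n\<close> and \<open>r\<close>, it remains to evaluate a sum over \<open>n\<close> for each \<open>r\<close>. At a
  primitive \<open>N\<close>-th root of unity the substitution \<open>n \<mapsto> N - n\<close>, \<open>r \<mapsto> N - r\<close> turns these into
  Schur's alternating sums of \<open>q\<close>-binomials, which have period three up to powers of \<open>q\<close>; this is
  where the three cases of \<open>alpha_hat\<close> come from. The exponent \<open>p r\<^sup>2\<close> is unaffected by the
  reflection.\<close>

section \<open>Gaussian polynomials and shifted factorials\<close>

text \<open>Built from the q-Pascal rule without division, so that it stays meaningful and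
  continuous in q at roots of unity, where the quotient \<open>qbinomial\<close> may degenerate to
  0/0.\<close>

fun gauss_binomial :: "'a::comm_ring_1 \<Rightarrow> nat \<Rightarrow> nat \<Rightarrow> 'a" where
  "gauss_binomial q n 0 = 1"
| "gauss_binomial q 0 (Suc k) = 0"
| "gauss_binomial q (Suc n) (Suc k) = gauss_binomial q n k + q ^ Suc k * gauss_binomial q n (Suc k)"

lemma gauss_binomial_eq_0: "n < k \<Longrightarrow> gauss_binomial q n k = 0"
  by (induction q n k rule: gauss_binomial.induct) auto

lemma gauss_binomial_self [simp]: "gauss_binomial q n n = 1"
  by (induction n) (auto simp: gauss_binomial_eq_0)

text \<open>The dual q-Pascal rule. Induction from the defining rule keeps it valid in every
  commutative ring, without cancelling factors 1 - q^j.\<close>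

lemma gauss_binomial_Suc_Suc':
  "k \<le> n \<Longrightarrow> gauss_binomial q (Suc n) (Suc k) = q ^ (n - k) * gauss_binomial q n k + gauss_binomial q n (Suc k)"
proof (induction n arbitrary: k)
  case (Suc n)
  show ?case
  proof (cases k)
    case 0
    then show ?thesis using Suc.IH[of 0] by (simp add: algebra_simps)
  next
    case k: (Suc k')
    show ?thesis
    proof (cases "k' = n")
      case True
      then show ?thesis using k by (simp add: gauss_binomial_eq_0)
    next
      case False
      with Suc.prems k have "k' < n" by simp
      then have "n - k' = Suc (n - Suc k')" by simp
      moreover have "q ^ n = q ^ k' * q ^ (n - k')"
        using \<open>k' < n\<close> by (simp flip: power_add)
      ultimately have qn: "q ^ n = q ^ k' * (q * q ^ (n - Suc k'))" "q ^ (n - k') = q * q ^ (n - Suc k')" by simp_all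
      have "gauss_binomial q (Suc (Suc n)) (Suc k)
          = gauss_binomial q (Suc n) (Suc k') + q ^ Suc k * gauss_binomial q (Suc n) (Suc (Suc k'))"
        using k by simp
      also have "gauss_binomial q (Suc n) (Suc (Suc k'))
          = q ^ (n - Suc k') * gauss_binomial q n (Suc k') + gauss_binomial q n (Suc (Suc k'))"
        using \<open>k' < n\<close> by (intro Suc.IH) simp
      also have "gauss_binomial q (Suc n) (Suc k') = q ^ (n - k') * gauss_binomial q n k' + gauss_binomial q n (Suc k')"
        using \<open>k' < n\<close> by (intro Suc.IH) simp
      finally have 1: "gauss_binomial q (Suc (Suc n)) (Suc k) = q ^ (n - k') * gauss_binomial q n k' + gauss_binomial q n (Suc k')
         + q ^ Suc k * (q ^ (n - Suc k') * gauss_binomial q n (Suc k') + gauss_binomial q n (Suc (Suc k')))" .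
      show ?thesis
        unfolding 1 by (simp add: k qn algebra_simps)
    qed
  qed
qed simp

text \<open>Equating the right-hand sides of the two q-Pascal rules gives the ratio of neighbours in
  a row, in multiplied-out form.\<close>

lemma gauss_binomial_Suc_right:
  assumes "k \<le> n"
  shows "gauss_binomial q n (Suc k) * (1 - q ^ Suc k) = gauss_binomial q n k * (1 - q ^ (n - k))"
proof -
  have "gauss_binomial q n k + q ^ Suc k * gauss_binomial q n (Suc k)
      = q ^ (n - k) * gauss_binomial q n k + gauss_binomial q n (Suc k)"
    using gauss_binomial_Suc_Suc'[OF assms, of q] by simp
  then show ?thesis by (simp add: algebra_simps del: power_Suc)
qed

lemma gauss_binomial_absorb:
  assumes "k \<le> n"
  shows "gauss_binomial q (Suc n) (Suc k) * (1 - q ^ Suc k) = gauss_binomial q n k * (1 - q ^ Suc n)"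
proof -
  have e: "q ^ Suc k * q ^ (n - k) = q ^ Suc n"
    using assms by (simp del: power_Suc flip: power_add)
  have "gauss_binomial q (Suc n) (Suc k) * (1 - q ^ Suc k)
     = gauss_binomial q (Suc n) (Suc k) - q ^ Suc k * gauss_binomial q (Suc n) (Suc k)"
    by (simp only: right_diff_distrib mult_1_right) (simp only: mult.commute)
  also have "\<dots> = (gauss_binomial q n k + q ^ Suc k * gauss_binomial q n (Suc k))
     - q ^ Suc k * (q ^ (n - k) * gauss_binomial q n k + gauss_binomial q n (Suc k))"
    by (simp only: gauss_binomial_Suc_Suc'[OF assms, symmetric] gauss_binomial.simps(3))
  also have "\<dots> = gauss_binomial q n k - q ^ Suc k * q ^ (n - k) * gauss_binomial q n k"
    by (simp only: algebra_simps)
  also have "\<dots> = gauss_binomial q n k * (1 - q ^ Suc n)"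
    unfolding e by (simp only: right_diff_distrib mult_1_right) (simp only: mult.commute)
  finally show ?thesis .
qed

lemma qpoch_0 [simp]: "qpoch q a 0 = 1"
  by (simp add: qpoch_def)

lemma qpoch_Suc: "qpoch q a (Suc n) = qpoch q a n * (1 - a * q ^ n)"
  by (simp add: qpoch_def)

lemma qpoch_add: "qpoch q a (m + n) = qpoch q a m * qpoch q (a * q ^ m) n"
  by (induction n) (simp_all add: qpoch_Suc power_add mult.assoc)

lemma gauss_binomial_mult_qpoch:
  "k \<le> n \<Longrightarrow> gauss_binomial q n k * (qpoch q q k * qpoch q q (n - k)) = qpoch q q n"
proof (induction k arbitrary: n)
  case (Suc k)
  then obtain n' where n: "n = Suc n'" "k \<le> n'" by (cases n) auto
  have "gauss_binomial q n (Suc k) * (qpoch q q (Suc k) * qpoch q q (n - Suc k))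
     = (gauss_binomial q (Suc n') (Suc k) * (1 - q ^ Suc k)) * qpoch q q k * qpoch q q (n' - k)"
    by (simp add: n qpoch_Suc mult_ac)
  also have "\<dots> = (1 - q ^ Suc n') * (gauss_binomial q n' k * (qpoch q q k * qpoch q q (n' - k)))"
    by (subst gauss_binomial_absorb[OF n(2)]) (simp add: mult_ac)
  also have "\<dots> = qpoch q q n"
    using Suc.IH[OF n(2)] by (simp add: n qpoch_Suc mult_ac)
  finally show ?case .
qed simp

lemma gauss_binomial_eq_qpoch:
  assumes "k \<le> n" "qpoch q q n \<noteq> 0"
  shows "gauss_binomial q n k = qpoch q q n / (qpoch q q (n - k) * qpoch q q k)"
proof -
  have "qpoch q q k * qpoch q q (n - k) \<noteq> 0"
    using gauss_binomial_mult_qpoch[OF assms(1), of q] assms(2) by auto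
  then show ?thesis
    using gauss_binomial_mult_qpoch[OF assms(1), of q] by (simp add: field_simps)
qed

text \<open>The reflection of the lower entry exchanges the two q-Pascal rules.\<close>

lemma gauss_binomial_symmetric:
  assumes "k \<le> n"
  shows "gauss_binomial q n (n - k) = gauss_binomial q n k"
  using assms
proof (induction n arbitrary: k)
  case (Suc n)
  show ?case
  proof (cases k)
    case k: (Suc j)
    show ?thesis
    proof (cases "j = n")
      case False
      with Suc.prems k have "j < n" by simp
      then have "Suc n - k = Suc (n - Suc j)" using k by simp
      then have "gauss_binomial q (Suc n) (Suc n - k)
          = q ^ (n - (n - Suc j)) * gauss_binomial q n (n - Suc j) + gauss_binomial q n (Suc (n - Suc j))"
        by (simp only:) (rule gauss_binomial_Suc_Suc', simp)
      also have "Suc (n - Suc j) = n - j" using \<open>j < n\<close> by simp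
      also have "n - (n - Suc j) = Suc j" using \<open>j < n\<close> by simp
      also have "gauss_binomial q n (n - Suc j) = gauss_binomial q n (Suc j)"
        using \<open>j < n\<close> by (intro Suc.IH) simp
      also have "gauss_binomial q n (n - j) = gauss_binomial q n j"
        using \<open>j < n\<close> by (intro Suc.IH) simp
      finally show ?thesis by (simp add: k)
    qed (simp add: k)
  qed simp
qed simp

lemma choose_2_Suc: "Suc k choose 2 = (k choose 2) + k"
  by (simp add: numeral_2_eq_2)

lemma double_choose_2: "2 * int (k choose 2) = int k * (int k - 1)"
  by (induction k) (simp_all add: choose_2_Suc algebra_simps binomial_eq_0)

section \<open>The sums of Schur type\<close>

text \<open>Schur's polynomials. At q = 1 they are the alternating diagonal sums of Pascal's
  triangle 1, 1, 0, -1, -1, 0, ..., of period six. Terms with 2l > n vanish.\<close>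

definition schur_sum :: "'a::comm_ring_1 \<Rightarrow> nat \<Rightarrow> 'a" where
  "schur_sum q n = (\<Sum>l\<le>n. (- 1) ^ l * q ^ (l choose 2) * gauss_binomial q (n - l) l)"

text \<open>The dual q-Pascal rule splits each term; since (l+1 choose 2) + n - 2l = (l choose 2) +
  n - l, the defect is the sum of length n weighted by q^(n-l).\<close>

lemma schur_sum_Suc_Suc:
  "schur_sum q (Suc (Suc n)) = schur_sum q (Suc n)
     - (\<Sum>l\<le>n. (- 1) ^ l * q ^ (l choose 2) * q ^ (n - l) * gauss_binomial q (n - l) l)"
proof -
  have step: "(- 1) ^ Suc l * q ^ (Suc l choose 2) * gauss_binomial q (Suc n - l) (Suc l)
      = (- 1) ^ Suc l * q ^ (Suc l choose 2) * gauss_binomial q (n - l) (Suc l)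
        - (- 1) ^ l * q ^ (l choose 2) * q ^ (n - l) * gauss_binomial q (n - l) l" if "l \<le> n" for l
  proof (cases "l \<le> n - l")
    case True
    then have "gauss_binomial q (Suc n - l) (Suc l) = q ^ (n - l - l) * gauss_binomial q (n - l) l + gauss_binomial q (n - l) (Suc l)"
      using gauss_binomial_Suc_Suc'[of l "n - l" q] that by (simp add: Suc_diff_le)
    moreover have "q ^ (Suc l choose 2) * q ^ (n - l - l) = q ^ (l choose 2) * q ^ (n - l)"
      using True by (simp add: choose_2_Suc flip: power_add)
    ultimately show ?thesis by (simp add: algebra_simps)
  next
    case False
    then show ?thesis using that by (simp add: gauss_binomial_eq_0)
  qed
  have "schur_sum q (Suc (Suc n)) = 1 + (\<Sum>l\<le>Suc n. (- 1) ^ Suc l * q ^ (Suc l choose 2) * gauss_binomial q (Suc n - l) (Suc l))"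
    unfolding schur_sum_def by (subst sum.atMost_Suc_shift) (simp add: binomial_eq_0)
  also have "\<dots> = 1 + (\<Sum>l\<le>n. (- 1) ^ Suc l * q ^ (Suc l choose 2) * gauss_binomial q (Suc n - l) (Suc l))"
    by (simp add: gauss_binomial_eq_0)
  also have "\<dots> = 1 + (\<Sum>l\<le>n. (- 1) ^ Suc l * q ^ (Suc l choose 2) * gauss_binomial q (n - l) (Suc l))
     - (\<Sum>l\<le>n. (- 1) ^ l * q ^ (l choose 2) * q ^ (n - l) * gauss_binomial q (n - l) l)"
    unfolding add_diff_eq[symmetric] sum_subtractf[symmetric]
    by (intro arg_cong2[of _ _ _ _ "(+)"] sum.cong refl step) simp
  also have "1 + (\<Sum>l\<le>n. (- 1) ^ Suc l * q ^ (Suc l choose 2) * gauss_binomial q (n - l) (Suc l)) = schur_sum q (Suc n)"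
    unfolding schur_sum_def by (subst sum.atMost_Suc_shift) (simp add: binomial_eq_0)
  finally show ?thesis .
qed

text \<open>The defining q-Pascal rule evaluates the weighted sum left over in
  \<open>schur_sum_Suc_Suc\<close>, because the weight absorbs the l-dependent powers of q and turns
  them into constant ones.\<close>

lemma schur_sum_weighted_Suc_Suc:
  "(\<Sum>l\<le>Suc (Suc n). (- 1) ^ l * q ^ (l choose 2) * q ^ (Suc (Suc n) - l) * gauss_binomial q (Suc (Suc n) - l) l)
     = q ^ Suc (Suc n) * schur_sum q (Suc n) - q ^ Suc n * schur_sum q n"
proof -
  have step: "(- 1) ^ Suc l * q ^ (Suc l choose 2) * q ^ (Suc n - l) * gauss_binomial q (Suc n - l) (Suc l)
      = q ^ Suc (Suc n) * ((- 1) ^ Suc l * q ^ (Suc l choose 2) * gauss_binomial q (n - l) (Suc l))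
        - q ^ Suc n * ((- 1) ^ l * q ^ (l choose 2) * gauss_binomial q (n - l) l)" if "l \<le> n" for l
  proof -
    have rec: "gauss_binomial q (Suc n - l) (Suc l) = gauss_binomial q (n - l) l + q ^ Suc l * gauss_binomial q (n - l) (Suc l)"
      using that by (simp add: Suc_diff_le)
    have exps: "q ^ (Suc l choose 2) * q ^ (Suc n - l) = q ^ Suc n * q ^ (l choose 2)"
      "q ^ (Suc n - l) * q ^ Suc l = q ^ Suc (Suc n)"
      using that by (simp_all add: choose_2_Suc add.commute del: power_Suc flip: power_add)
    have "- a * u * x * (G + y * H) = (x * y) * (- a * u * H) - (u * x) * (a * G)" for a u x y G H :: 'a
      by (simp add: algebra_simps)
    from this[of "(- 1) ^ l" "q ^ (Suc l choose 2)" "q ^ (Suc n - l)"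
        "gauss_binomial q (n - l) l" "q ^ Suc l" "gauss_binomial q (n - l) (Suc l)"] show ?thesis
      unfolding rec exps by (simp add: mult_ac)
  qed
  have "(\<Sum>l\<le>Suc (Suc n). (- 1) ^ l * q ^ (l choose 2) * q ^ (Suc (Suc n) - l) * gauss_binomial q (Suc (Suc n) - l) l)
    = q ^ Suc (Suc n) + (\<Sum>l\<le>Suc n. (- 1) ^ Suc l * q ^ (Suc l choose 2) * q ^ (Suc n - l) * gauss_binomial q (Suc n - l) (Suc l))"
    by (subst sum.atMost_Suc_shift) (simp add: binomial_eq_0)
  also have "\<dots> = q ^ Suc (Suc n) + (\<Sum>l\<le>n. (- 1) ^ Suc l * q ^ (Suc l choose 2) * q ^ (Suc n - l) * gauss_binomial q (Suc n - l) (Suc l))"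
    by (simp add: gauss_binomial_eq_0)
  also have "\<dots> = q ^ Suc (Suc n) * (1 + (\<Sum>l\<le>n. (- 1) ^ Suc l * q ^ (Suc l choose 2) * gauss_binomial q (n - l) (Suc l)))
     - q ^ Suc n * schur_sum q n"
    by (simp add: sum_distrib_left distrib_left schur_sum_def step sum_subtractf del: power_Suc)
  also have "1 + (\<Sum>l\<le>n. (- 1) ^ Suc l * q ^ (Suc l choose 2) * gauss_binomial q (n - l) (Suc l)) = schur_sum q (Suc n)"
    unfolding schur_sum_def by (subst sum.atMost_Suc_shift) (simp add: binomial_eq_0)
  finally show ?thesis .
qed

text \<open>Writing S for \<open>schur_sum q\<close>, the two previous lemmas give S(n+4) = S(n+3) -
  q^(n+2) S(n+1) + q^(n+1) S(n). By the induction hypothesis the first and last terms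
  cancel.\<close>

lemma schur_sum_add_3: "schur_sum q (n + 3) = - (q ^ (n + 1) * schur_sum q n)"
proof (induction n)
  case 0
  show ?case by (simp add: schur_sum_def numeral_3_eq_3 numeral_2_eq_2)
next
  case (Suc n)
  have "schur_sum q (Suc n + 3) = schur_sum q (n + 3) - (q ^ (n + 2) * schur_sum q (Suc n) - q ^ (n + 1) * schur_sum q n)"
    using schur_sum_Suc_Suc[of q "n + 2"] schur_sum_weighted_Suc_Suc[of q n] by (simp add: numeral_3_eq_3)
  then show ?case using Suc.IH by simp
qed

lemma schur_sum_values:
  "schur_sum q (6 * r) = q ^ (6 * r\<^sup>2 - r)" "schur_sum q (6 * r + 2) = 0"
  "schur_sum q (6 * r + 4) = - (q ^ (6 * r\<^sup>2 + 7 * r + 2))"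
proof -
  \<comment> \<open>The three-step rule applied twice; the signs cancel and the exponents n+4 and
    n+1 add up.\<close>
  have step: "schur_sum q (n + 6) = q ^ (2 * n + 5) * schur_sum q n" for n
  proof -
    have "q ^ (2 * n + 5) = q ^ (n + 3 + 1) * q ^ (n + 1)"
      unfolding power_add[symmetric] by (intro arg_cong[of _ _ "(^) q"]) simp
    then show ?thesis
      using schur_sum_add_3[of q "n + 3"] schur_sum_add_3[of q n] by (simp add: add.assoc mult.assoc)
  qed
  have e: "6 * (Suc r)\<^sup>2 - Suc r = (2 * (6 * r) + 5) + (6 * r\<^sup>2 - r)" for r :: nat
  proof -
    have "r \<le> 6 * r\<^sup>2" using self_le_power[of r 2] by (cases r) auto
    then show ?thesis by (simp add: power2_eq_square)
  qed
  show "schur_sum q (6 * r) = q ^ (6 * r\<^sup>2 - r)"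
  proof (induction r)
    case (Suc r)
    then show ?case using step[of "6 * r"] unfolding e by (simp add: power_add add.commute)
  qed (simp add: schur_sum_def binomial_eq_0)
  show "schur_sum q (6 * r + 2) = 0"
  proof (induction r)
    case (Suc r)
    then show ?case using step[of "6 * r + 2"] by (simp add: add_ac)
  qed (simp add: schur_sum_def numeral_2_eq_2)
  show "schur_sum q (6 * r + 4) = - (q ^ (6 * r\<^sup>2 + 7 * r + 2))"
  proof (induction r)
    case 0
    show ?case using schur_sum_add_3[of q 1] by (simp add: schur_sum_def power2_eq_square binomial_eq_0)
  next
    case (Suc r)
    have "6 * (Suc r)\<^sup>2 + 7 * Suc r + 2 = (2 * (6 * r + 4) + 5) + (6 * r\<^sup>2 + 7 * r + 2)"
      by (simp add: power2_eq_square)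
    then have e: "q ^ (6 * (Suc r)\<^sup>2 + 7 * Suc r + 2) = q ^ (2 * (6 * r + 4) + 5) * q ^ (6 * r\<^sup>2 + 7 * r + 2)"
      by (simp only: power_add)
    have "6 * Suc r + 4 = (6 * r + 4) + 6" by simp
    then show ?case unfolding e by (simp only: step Suc.IH mult_minus_right)
  qed
qed

text \<open>The three cases of \<open>alpha_hat\<close> become one formula because Schur's sum
  vanishes at indices 2 mod 6: one summand survives for k = 0 or 1 mod 3, and both survive for k = 2
  mod 3.\<close>

lemma alpha_hat_eq_schur_sum:
  "alpha_hat q k = schur_sum q (2 * k + 2) + q ^ k * schur_sum q (2 * k)"
proof -
  have nat_le: "s \<le> 6 * s\<^sup>2" "2 * s \<le> 6 * s\<^sup>2" for s :: nat
    using self_le_power[of s 2] by (cases s; auto)+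
  have "k = 3 * (k div 3) \<or> k = 3 * (k div 3) + 1 \<or> k = 3 * (Suc (k div 3)) - 1" by presburger
  then consider r where "k = 3 * r" | r where "k = 3 * r + 1" | r where "k = 3 * Suc r - 1" by blast
  then show ?thesis
  proof cases
    case (1 r)
    have "alpha_hat q k = q powi int (6 * r\<^sup>2 + 2 * r)"
      unfolding 1 alpha_hat_3r by simp
    also have "\<dots> = q ^ (3 * r) * q ^ (6 * r\<^sup>2 - r)"
      using nat_le(1)[of r] unfolding power_int_of_nat power_add[symmetric] by (intro arg_cong[of _ _ "\<lambda>x. q ^ x"]) linarith
    finally show ?thesis using schur_sum_values(1,2)[of q r] by (simp add: 1)
  next
    case (2 r)
    have "alpha_hat q k = - (q powi int (6 * r\<^sup>2 + 7 * r + 2))"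
      unfolding 2 alpha_hat_3r_plus_1 by (simp add: add_ac)
    moreover have "2 * k + 2 = 6 * r + 4" "2 * k = 6 * r + 2" using 2 by simp_all
    ultimately show ?thesis unfolding power_int_of_nat
      by (simp only: schur_sum_values mult_zero_right add_0_right)
  next
    case (3 r)
    have "alpha_hat q k = q powi int (6 * (Suc r)\<^sup>2 - Suc r) - q powi int (6 * (Suc r)\<^sup>2 - 2 * Suc r)"
      using nat_le[of "Suc r"] unfolding 3
      by (subst alpha_hat_3r_minus_1) (simp_all add: of_nat_diff)
    moreover have "6 * (Suc r)\<^sup>2 - 2 * Suc r = k + (6 * r\<^sup>2 + 7 * r + 2)"
      using 3 by (simp add: power2_eq_square)
    moreover have "2 * k + 2 = 6 * Suc r" "2 * k = 6 * r + 4" using 3 by simp_all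
    ultimately show ?thesis unfolding power_int_of_nat
      by (simp only: schur_sum_values power_add[of q k] mult_minus_right diff_conv_add_uminus)
  qed
qed

section \<open>The Bailey chain starting from the unit pair\<close>

text \<open>A limiting q-Chu-Vandermonde sum with denominators cleared. The dual q-Pascal rule
  writes the sum for M+1 as c q^(M+1) times the sum for cq plus 1 - c q^(M+1) times the sum for c,
  both of length M; hence the induction is over all c.\<close>

lemma bailey_kernel_sum:
  "(\<Sum>s\<le>M. q ^ s\<^sup>2 * c ^ s * gauss_binomial q M s * qpoch q (c * q ^ Suc s) (M - s)) = 1"
proof (induction M arbitrary: c)
  case (Suc M)
  let ?t = "\<lambda>c s. q ^ s\<^sup>2 * c ^ s * gauss_binomial q M s * qpoch q (c * q ^ Suc s) (M - s)"
  have step: "q ^ (Suc s)\<^sup>2 * c ^ Suc s * gauss_binomial q (Suc M) (Suc s) * qpoch q (c * q ^ Suc (Suc s)) (M - s)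
      = c * q ^ Suc M * ?t (c * q) s
        + q ^ (Suc s)\<^sup>2 * c ^ Suc s * gauss_binomial q M (Suc s) * qpoch q (c * q ^ Suc (Suc s)) (M - s)"
    if "s \<le> M" for s
  proof -
    have "q ^ (Suc s)\<^sup>2 * q ^ (M - s) = q ^ (Suc M + s\<^sup>2 + s)"
      using that unfolding power_add[symmetric] by (intro arg_cong[of _ _ "(^) q"]) (simp add: power2_eq_square)
    then have "q ^ (Suc s)\<^sup>2 * q ^ (M - s) = q ^ Suc M * q ^ s\<^sup>2 * q ^ s"
      by (simp only: power_add)
    moreover have "A * (c * d) * (m * G + H) * Q = c * S * (T * (d * V) * G * Q) + A * (c * d) * H * Q"
      if "A * m = S * T * V" for A m S T V d G H Q :: complex
    proof -
      have "A * (c * d) * (m * G + H) * Q = (A * m) * (c * d * G * Q) + A * (c * d) * H * Q"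
        by (simp add: algebra_simps)
      then show ?thesis unfolding that by (simp add: mult_ac)
    qed
    moreover have "c * q ^ Suc (Suc s) = c * q * q ^ Suc s" by simp
    ultimately show ?thesis
      unfolding gauss_binomial_Suc_Suc'[OF that] power_mult_distrib power_Suc[of c] by (simp only:)
  qed
  have last: "q ^ s\<^sup>2 * c ^ s * gauss_binomial q M s * qpoch q (c * q ^ Suc s) (Suc M - s)
      = (1 - c * q ^ Suc M) * ?t c s" if "s \<le> M" for s
  proof -
    have "q ^ Suc s * q ^ (M - s) = q ^ Suc M"
      using that by (simp del: power_Suc flip: power_add)
    then show ?thesis
      using that by (simp add: Suc_diff_le qpoch_Suc mult.assoc del: power_Suc)
  qed
  have "(\<Sum>s\<le>Suc M. q ^ s\<^sup>2 * c ^ s * gauss_binomial q (Suc M) s * qpoch q (c * q ^ Suc s) (Suc M - s))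
    = qpoch q (c * q) (Suc M)
      + (\<Sum>s\<le>M. q ^ (Suc s)\<^sup>2 * c ^ Suc s * gauss_binomial q (Suc M) (Suc s) * qpoch q (c * q ^ Suc (Suc s)) (M - s))"
    by (subst sum.atMost_Suc_shift) simp
  also have "\<dots> = c * q ^ Suc M * (\<Sum>s\<le>M. ?t (c * q) s) + (qpoch q (c * q) (Suc M)
      + (\<Sum>s\<le>M. q ^ (Suc s)\<^sup>2 * c ^ Suc s * gauss_binomial q M (Suc s) * qpoch q (c * q ^ Suc (Suc s)) (M - s)))"
    by (simp add: step sum.distrib sum_distrib_left del: power_Suc gauss_binomial.simps(3))
  also have "qpoch q (c * q) (Suc M)
      + (\<Sum>s\<le>M. q ^ (Suc s)\<^sup>2 * c ^ Suc s * gauss_binomial q M (Suc s) * qpoch q (c * q ^ Suc (Suc s)) (M - s))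
      = (\<Sum>s\<le>Suc M. q ^ s\<^sup>2 * c ^ s * gauss_binomial q M s * qpoch q (c * q ^ Suc s) (Suc M - s))"
    by (subst sum.atMost_Suc_shift) simp
  also have "\<dots> = (1 - c * q ^ Suc M) * (\<Sum>s\<le>M. ?t c s)"
    by (simp add: last sum_distrib_left gauss_binomial_eq_0 del: power_Suc)
  finally show ?case
    by (simp only: Suc.IH mult_1_right add_diff_eq add_diff_cancel_left')
qed simp

text \<open>This is (q)_n beta_n along the Bailey chain, starting from the unit pair. The first step
  only picks out m = 0 and gives the constant 1, so level \<open>p\<close> contains the p - 1 inner
  sums of \<open>H10_summand\<close>.\<close>

fun bailey_iterate :: "complex \<Rightarrow> nat \<Rightarrow> nat \<Rightarrow> complex" where
  "bailey_iterate q 0 n = (if n = 0 then 1 else 0)"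
| "bailey_iterate q (Suc p) n = (\<Sum>m\<le>n. q ^ m\<^sup>2 * gauss_binomial q n m * bailey_iterate q p m)"

lemma bailey_iterate_1 [simp]: "bailey_iterate q (Suc 0) n = 1"
  by (simp add: sum.atMost_shift)

lemma qpoch_nonzero:
  assumes "norm q < 1" "norm a < 1"
  shows "qpoch q a n \<noteq> 0"
proof -
  have "a * q ^ k \<noteq> 1" for k
  proof
    assume "a * q ^ k = 1"
    moreover have "norm (a * q ^ k) \<le> norm a * 1"
      unfolding norm_mult norm_power using assms by (intro mult_left_mono power_le_one) auto
    ultimately show False using assms by simp
  qed
  then show ?thesis by (simp add: qpoch_def)
qed

text \<open>(q)_n times the kernel 1/((q)_(n-r) (aq)_(n+r)) of a Bailey pair relative to a =
  1.\<close>

definition bailey_kernel :: "complex \<Rightarrow> nat \<Rightarrow> nat \<Rightarrow> complex" where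
  "bailey_kernel q n r = qpoch q q n / (qpoch q q (n - r) * qpoch q q (n + r))"

text \<open>Bailey's lemma with both parameters sent to infinity, on the level of the kernel: one
  step of the chain multiplies alpha_r by q^(r^2).\<close>

lemma bailey_kernel_step:
  assumes "norm q < 1" "r \<le> n"
  shows "(\<Sum>m=r..n. q ^ m\<^sup>2 * gauss_binomial q n m * bailey_kernel q m r) = q ^ r\<^sup>2 * bailey_kernel q n r"
proof -
  note nz = qpoch_nonzero[OF assms(1) assms(1)]
  define M where "M = n - r"
  have n: "n = M + r" using assms(2) by (simp add: M_def)
  have "(\<Sum>m=r..n. q ^ m\<^sup>2 * gauss_binomial q n m * bailey_kernel q m r)
      = (\<Sum>s\<le>M. q ^ (s + r)\<^sup>2 * gauss_binomial q n (s + r) * bailey_kernel q (s + r) r)"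
    using sum.shift_bounds_cl_nat_ivl[of _ 0 r M] by (simp add: n atMost_atLeast0)
  \<comment> \<open>With m = s + r, the quotient of the summand by the claimed value is the summand
    of \<open>bailey_kernel_sum\<close> at c = q^(2r), M = n - r.\<close>
  also have "\<dots> = (\<Sum>s\<le>M. q ^ r\<^sup>2 * bailey_kernel q n r *
      (q ^ s\<^sup>2 * (q ^ (2 * r)) ^ s * gauss_binomial q M s * qpoch q (q ^ (2 * r) * q ^ Suc s) (M - s)))"
  proof (rule sum.cong[OF refl])
    fix s assume "s \<in> {..M}"
    then have s: "s \<le> M" by simp
    have cancel: "P * (X * Y) * (Q / (a * b)) * (b / (e * d)) = P * (Q / (g * (d * W))) * (X * Y * (g / (a * e)) * W)"
      if "b \<noteq> 0" "g \<noteq> 0" "W \<noteq> 0" for P X Y Q a b d e g W :: complex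
      using that by (simp add: field_simps)
    have e1: "gauss_binomial q n (s + r) = qpoch q q n / (qpoch q q (M - s) * qpoch q q (s + r))"
      using gauss_binomial_eq_qpoch[of "s + r" n q] s nz by (simp add: n)
    have e2: "gauss_binomial q M s = qpoch q q M / (qpoch q q (M - s) * qpoch q q s)"
      using gauss_binomial_eq_qpoch[of s M q] s nz by simp
    have e3: "qpoch q q (n + r) = qpoch q q (s + r + r) * qpoch q (q ^ (2 * r) * q ^ Suc s) (M - s)"
    proof -
      have "q * q ^ (s + r + r) = q ^ (2 * r) * q ^ Suc s"
        by (simp add: mult_2 power_add)
      moreover have "n + r = (s + r + r) + (M - s)" using s n by simp
      ultimately show ?thesis using qpoch_add[of q q "s + r + r" "M - s"] by (simp only:)
    qed
    have e4: "q ^ (s + r)\<^sup>2 = q ^ r\<^sup>2 * (q ^ s\<^sup>2 * (q ^ (2 * r)) ^ s)"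
    proof -
      have "(s + r)\<^sup>2 = r\<^sup>2 + (s\<^sup>2 + 2 * r * s)" by (simp add: power2_eq_square algebra_simps)
      then show ?thesis by (simp only: power_add power_mult)
    qed
    have e5: "bailey_kernel q (s + r) r = qpoch q q (s + r) / (qpoch q q s * qpoch q q (s + r + r))"
      "bailey_kernel q n r = qpoch q q n / (qpoch q q M * qpoch q q (n + r))"
      by (simp_all add: bailey_kernel_def n)
    have W: "qpoch q (q ^ (2 * r) * q ^ Suc s) (M - s) \<noteq> 0"
      using nz[of "n + r"] unfolding e3 mult_eq_0_iff by blast
    show "q ^ (s + r)\<^sup>2 * gauss_binomial q n (s + r) * bailey_kernel q (s + r) r
      = q ^ r\<^sup>2 * bailey_kernel q n r *
      (q ^ s\<^sup>2 * (q ^ (2 * r)) ^ s * gauss_binomial q M s * qpoch q (q ^ (2 * r) * q ^ Suc s) (M - s))"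
      unfolding e1 e2 e4 e5 e3 by (rule cancel[OF nz nz W])
  qed
  also have "\<dots> = q ^ r\<^sup>2 * bailey_kernel q n r"
    by (simp only: bailey_kernel_sum mult_1_right flip: sum_distrib_left)
  finally show ?thesis .
qed

section \<open>The unit Bailey pair and its folded form\<close>

text \<open>The unit pair has alpha_0 = 1 and alpha_r = (-1)^r q^(r choose 2) (1 + q^r) for r >= 1.
  The uniform formula gives 2 at r = 0, hence the weight 1/2.\<close>

definition half_at_0 :: "nat \<Rightarrow> complex" where
  "half_at_0 r = (if r = 0 then 1 / 2 else 1)"

text \<open>For \<open>q\<close> not a root of unity this is \<open>(1 + q\<^sup>r) / (1 + q\<^sup>n)\<close> times the Gaussian
  binomial coefficient of \<open>2n\<close> over \<open>n - r\<close>, in a form without denominators;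
  in particular the value at \<open>n = r = 0\<close> is \<open>1\<close>.\<close>

definition folded_binomial :: "complex \<Rightarrow> nat \<Rightarrow> nat \<Rightarrow> complex" where
  "folded_binomial q n r = (if n = 0 then 1 else
     gauss_binomial q (2 * n - 1) (n - r) + q ^ r * gauss_binomial q (2 * n - 1) (n + r))"

text \<open>The factor (q^n)_n (q)_n equals (q)_(2n-1) (1 - q^n), and (1 + q^r)(1 - q^n) = (1 -
  q^(n+r)) + q^r (1 - q^(n-r)) splits the quotient into two Gaussian binomials with upper entry 2n -
  1.\<close>

lemma bailey_kernel_eq_folded_binomial:
  assumes "norm q < 1" "1 \<le> n" "r \<le> n"
  shows "qpoch q (q ^ n) n * ((1 + q ^ r) * bailey_kernel q n r) = folded_binomial q n r"
proof -
  note nz = qpoch_nonzero[OF assms(1) assms(1)]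
  obtain k where k: "n = Suc k" using assms(2) by (cases n) auto
  have rec: "qpoch q q (Suc j) = qpoch q q j * (1 - q ^ Suc j)" for j
    by (simp add: qpoch_Suc)
  define D where "D = qpoch q q (n - r) * qpoch q q (n + r)"
  have D: "D \<noteq> 0" using nz by (simp add: D_def)
  have 1: "gauss_binomial q (2 * n - 1) (n - r) * D = qpoch q q (2 * n - 1) * (1 - q ^ (n + r))"
  proof -
    have "n + r = Suc (2 * n - 1 - (n - r))" using assms by simp
    then have "qpoch q q (n + r) = qpoch q q (2 * n - 1 - (n - r)) * (1 - q ^ (n + r))"
      by (simp only: rec)
    moreover have "n - r \<le> 2 * n - 1" using assms by simp
    note gauss_binomial_mult_qpoch[OF this, of q, symmetric]
    ultimately show ?thesis by (simp only: D_def mult.assoc)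
  qed
  have 2: "gauss_binomial q (2 * n - 1) (n + r) * D = qpoch q q (2 * n - 1) * (1 - q ^ (n - r))"
  proof (cases "r = n")
    case True
    then show ?thesis using assms by (simp add: gauss_binomial_eq_0)
  next
    case False
    then have "n - r = Suc (2 * n - 1 - (n + r))" using assms by simp
    then have "qpoch q q (n - r) = qpoch q q (2 * n - 1 - (n + r)) * (1 - q ^ (n - r))"
      by (simp only: rec)
    moreover have "n + r \<le> 2 * n - 1" using assms False by simp
    note gauss_binomial_mult_qpoch[OF this, of q, symmetric]
    ultimately show ?thesis by (simp only: D_def mult_ac)
  qed
  have 3: "qpoch q (q ^ n) n * qpoch q q n = qpoch q q (2 * n - 1) * (1 - q ^ n)"
  proof -
    have "2 * n - 1 = k + n" using k by simp
    moreover have "qpoch q q (k + n) = qpoch q q k * qpoch q (q ^ n) n"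
      using qpoch_add[of q q k n] unfolding k by (simp only: power_Suc)
    moreover have "qpoch q q n = qpoch q q k * (1 - q ^ n)"
      unfolding k by (rule rec)
    ultimately show ?thesis by (simp only: mult_ac)
  qed
  have "(1 + q ^ r) * (1 - q ^ n) = (1 - q ^ (n + r)) + q ^ r * (1 - q ^ (n - r))"
  proof -
    have "q ^ n = q ^ r * q ^ (n - r)" using assms by (simp flip: power_add)
    then show ?thesis by (simp add: algebra_simps power_add)
  qed
  moreover have "folded_binomial q n r * D = gauss_binomial q (2 * n - 1) (n - r) * D
      + q ^ r * (gauss_binomial q (2 * n - 1) (n + r) * D)"
    using assms by (simp add: folded_binomial_def algebra_simps)
  ultimately have "folded_binomial q n r * D = qpoch q q (2 * n - 1) * ((1 + q ^ r) * (1 - q ^ n))"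
    unfolding 1 2 by (simp only: distrib_left mult_ac)
  then have "folded_binomial q n r * D = (1 + q ^ r) * (qpoch q (q ^ n) n * qpoch q q n)"
    unfolding 3 by (simp only: mult_ac)
  then have "folded_binomial q n r * D = qpoch q (q ^ n) n * ((1 + q ^ r) * qpoch q q n)"
    by (simp only: mult_ac)
  then show ?thesis
    unfolding bailey_kernel_def D_def[symmetric] times_divide_eq_right nonzero_divide_eq_eq[OF D] by (rule sym)
qed

text \<open>The sum telescopes: its r-th term is \<open>u r - u (Suc r)\<close> for r >= 1, and
  \<open>- u 1\<close> for r = 0 by symmetry and the weight 1/2. The end \<open>u (Suc n)\<close>
  has lower entry 2n > 2n - 1.\<close>

lemma sum_folded_binomial_eq_0:
  assumes "1 \<le> n"
  shows "(\<Sum>r\<le>n. half_at_0 r * (- 1) ^ r * q ^ (r choose 2) * folded_binomial q n r) = 0"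
proof -
  define u where "u r = (- 1) ^ r * q ^ (r choose 2) * gauss_binomial q (2 * n - 1) (n + r - 1)" for r
  have sym: "gauss_binomial q (2 * n - 1) (n - r) = gauss_binomial q (2 * n - 1) (n + r - 1)" if "r \<le> n" for r
    using gauss_binomial_symmetric[of "n - r" "2 * n - 1" q] that assms by (simp add: algebra_simps)
  have "(\<Sum>r\<le>R. half_at_0 r * (- 1) ^ r * q ^ (r choose 2) * folded_binomial q n r) = - u (Suc R)" if "R \<le> n" for R
    using that
  proof (induction R)
    case 0
    then show ?case using assms sym[of 0] by (simp add: half_at_0_def folded_binomial_def u_def binomial_eq_0)
  next
    case (Suc R)
    then show ?case using sym[of "Suc R"] assms
      by (simp add: half_at_0_def folded_binomial_def u_def choose_2_Suc[of "Suc R"] power_add algebra_simps)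
  qed
  then have "(\<Sum>r\<le>n. half_at_0 r * (- 1) ^ r * q ^ (r choose 2) * folded_binomial q n r) = - u (Suc n)" by blast
  then show ?thesis using assms by (simp add: u_def gauss_binomial_eq_0)
qed

lemma bailey_iterate_eq_kernel_sum:
  assumes "norm q < 1"
  shows "bailey_iterate q p n
     = (\<Sum>r\<le>n. half_at_0 r * (- 1) ^ r * q ^ (r choose 2) * (1 + q ^ r) * q ^ (p * r\<^sup>2) * bailey_kernel q n r)"
proof (induction p arbitrary: n)
  case 0
  show ?case
  proof (cases "n = 0")
    case True
    then show ?thesis by (simp add: half_at_0_def bailey_kernel_def binomial_eq_0)
  next
    case False
    \<comment> \<open>The nonzero factor (q^n)_n turns the orthogonality relation of the unit pair
      into the telescoping sum.\<close>
    have "qpoch q (q ^ n) n * (\<Sum>r\<le>n. half_at_0 r * (- 1) ^ r * q ^ (r choose 2) * (1 + q ^ r) * q ^ (0 * r\<^sup>2) * bailey_kernel q n r)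
       = (\<Sum>r\<le>n. half_at_0 r * (- 1) ^ r * q ^ (r choose 2) * folded_binomial q n r)"
      unfolding sum_distrib_left
      using False by (intro sum.cong refl)
        (simp add: assms mult_ac flip: bailey_kernel_eq_folded_binomial)
    also have "\<dots> = 0" using False by (intro sum_folded_binomial_eq_0) simp
    finally show ?thesis
      using qpoch_nonzero[OF assms, of "q ^ n" n] assms False by (simp add: norm_power power_less_one_iff)
  qed
next
  case (Suc p)
  define w where "w r = half_at_0 r * (- 1) ^ r * q ^ (r choose 2) * (1 + q ^ r)" for r
  have "bailey_iterate q (Suc p) n
     = (\<Sum>m\<le>n. \<Sum>r\<le>m. w r * q ^ (p * r\<^sup>2) * (q ^ m\<^sup>2 * gauss_binomial q n m * bailey_kernel q m r))"
    by (simp add: Suc.IH sum_distrib_left w_def mult_ac)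
  also have "\<dots> = (\<Sum>r\<le>n. \<Sum>m=r..n. w r * q ^ (p * r\<^sup>2) * (q ^ m\<^sup>2 * gauss_binomial q n m * bailey_kernel q m r))"
    by (simp add: sum.Sigma) (rule sum.reindex_bij_witness[of _ prod.swap prod.swap], auto)
  also have "\<dots> = (\<Sum>r\<le>n. w r * q ^ (p * r\<^sup>2) * (q ^ r\<^sup>2 * bailey_kernel q n r))"
    by (intro sum.cong refl) (simp add: bailey_kernel_step[OF assms] flip: sum_distrib_left)
  also have "\<dots> = (\<Sum>r\<le>n. w r * q ^ (Suc p * r\<^sup>2) * bailey_kernel q n r)"
    by (simp add: power_add mult_ac)
  finally show ?case by (simp add: w_def)
qed

section \<open>Continuation from the open disc to the unit circle\<close>

lemma continuous_on_gauss_binomial [continuous_intros]: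
  "continuous_on UNIV (\<lambda>q :: complex. gauss_binomial q n k)"
proof (induction n arbitrary: k)
  case 0
  show ?case by (cases k) simp_all
next
  case (Suc n)
  then show ?case by (cases k) (auto intro!: continuous_intros)
qed

lemma continuous_on_bailey_iterate: "continuous_on UNIV (\<lambda>q. bailey_iterate q p n)"
  by (induction p arbitrary: n) (auto intro!: continuous_intros)

text \<open>Both sides are free of denominators and continuous in q. They agree on the open unit
  disc by the kernel expansion, hence on its closure, which contains all roots of unity.\<close>

lemma bailey_iterate_eq_folded_sum:
  assumes "norm q \<le> 1" "1 \<le> n"
  shows "qpoch q (q ^ n) n * bailey_iterate q p n
     = (\<Sum>r\<le>n. half_at_0 r * (- 1) ^ r * q ^ ((r choose 2) + p * r\<^sup>2) * folded_binomial q n r)"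
proof -
  let ?L = "\<lambda>q. qpoch q (q ^ n) n * bailey_iterate q p n"
  let ?R = "\<lambda>q. \<Sum>r\<le>n. half_at_0 r * (- 1) ^ r * q ^ ((r choose 2) + p * r\<^sup>2) * folded_binomial q n r"
  have "closed {q. ?L q = ?R q}"
    unfolding folded_binomial_def qpoch_def using assms(2)
    by (intro closed_Collect_eq) (auto intro!: continuous_intros continuous_on_bailey_iterate)
  moreover have "ball 0 1 \<subseteq> {q. ?L q = ?R q}"
  proof
    fix q :: complex assume "q \<in> ball 0 1"
    then have q: "norm q < 1" by simp
    have "?L q = ?R q"
      unfolding bailey_iterate_eq_kernel_sum[OF q] sum_distrib_left
      using assms(2) by (intro sum.cong refl)
        (simp add: q power_add mult_ac flip: bailey_kernel_eq_folded_binomial)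
    then show "q \<in> {q. ?L q = ?R q}" by simp
  qed
  ultimately have "closure (ball 0 1) \<subseteq> {q. ?L q = ?R q}" by (rule closure_minimal[rotated])
  then show ?thesis using assms(1) by (auto simp: subset_iff)
qed

section \<open>The multisum as an iterated sum\<close>

definition tuples_ending_in :: "nat \<Rightarrow> nat \<Rightarrow> (nat \<Rightarrow> nat) set" where
  "tuples_ending_in p n = {x \<in> monotone_tuples p. x p = n}"

lemma tuples_ending_in_1: "tuples_ending_in (Suc 0) n = {\<lambda>i\<in>{1}. n}"
  by (auto simp: tuples_ending_in_def monotone_tuples_def PiE_def extensional_def fun_eq_iff)

lemma tuples_ending_in_Suc:
  assumes "1 \<le> p"
  shows "tuples_ending_in (Suc p) n = (\<Union>m\<le>n. (\<lambda>x. x(Suc p := n)) ` tuples_ending_in p m)"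
proof (intro equalityI subsetI)
  fix x assume "x \<in> tuples_ending_in (Suc p) n"
  then have x: "x \<in> extensional {1..Suc p}" "\<And>i. 1 \<le> i \<Longrightarrow> i < Suc p \<Longrightarrow> x i \<le> x (i + 1)" "x (Suc p) = n"
    by (auto simp: tuples_ending_in_def monotone_tuples_def PiE_def)
  \<comment> \<open>Resetting the last entry to the dummy value makes the shortened tuple
    extensional on \<open>{1..p}\<close>.\<close>
  have "x(Suc p := undefined) \<in> tuples_ending_in p (x p)"
    using x by (auto simp: tuples_ending_in_def monotone_tuples_def PiE_def extensional_def)
  moreover have "x = (x(Suc p := undefined))(Suc p := n)" using x(3) by auto
  moreover have "x p \<le> n" using x(2)[of p] x(3) assms by simp
  ultimately show "x \<in> (\<Union>m\<le>n. (\<lambda>x. x(Suc p := n)) ` tuples_ending_in p m)" by blast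
next
  fix x assume "x \<in> (\<Union>m\<le>n. (\<lambda>x. x(Suc p := n)) ` tuples_ending_in p m)"
  then obtain m y where "m \<le> n" "y \<in> tuples_ending_in p m" "x = y(Suc p := n)" by blast
  then show "x \<in> tuples_ending_in (Suc p) n"
    by (auto simp: tuples_ending_in_def monotone_tuples_def PiE_def extensional_def less_Suc_eq)
qed

lemma finite_tuples_ending_in: "1 \<le> p \<Longrightarrow> finite (tuples_ending_in p n)"
proof (induction p arbitrary: n rule: nat_induct_at_least)
  case base
  show ?case using tuples_ending_in_1 by simp
qed (simp add: tuples_ending_in_Suc)

lemma primitive_root_power_eq_1_iff:
  assumes "primitive_root_of_unity N q"
  shows "q ^ k = 1 \<longleftrightarrow> N dvd k"
proof -
  have "q ^ k = (q ^ N) ^ (k div N) * q ^ (k mod N)"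
    by (simp flip: power_mult power_add)
  then have "q ^ k = q ^ (k mod N)" using assms by (simp add: primitive_root_of_unity_def)
  moreover have "k mod N < N" using assms by (simp add: primitive_root_of_unity_def)
  ultimately show ?thesis
    using assms by (auto simp: primitive_root_of_unity_def dvd_eq_mod_eq_0)
qed

lemma qpoch_primitive_root_nonzero:
  assumes "primitive_root_of_unity N q" "n < N"
  shows "qpoch q q n \<noteq> 0"
proof -
  have "q * q ^ (k - 1) \<noteq> 1" if "k \<in> {1..n}" for k
  proof -
    have "q * q ^ (k - 1) = q ^ k" using that by (cases k) auto
    moreover have "\<not> N dvd k" using that assms(2) by (auto dest: dvd_imp_le)
    ultimately show ?thesis using primitive_root_power_eq_1_iff[OF assms(1)] by simp
  qed
  then show ?thesis by (simp add: qpoch_def)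
qed

text \<open>Splitting by the entry m at position p peels off one factor and reproduces the recursion
  of \<open>bailey_iterate\<close>. The bound n < N keeps every denominator nonzero.\<close>

lemma sum_tuples_ending_in:
  assumes "1 \<le> p" "primitive_root_of_unity N q" "n < N"
  shows "(\<Sum>x\<in>tuples_ending_in p n. \<Prod>i=1..p-1. q ^ ((x i)\<^sup>2) * qbinomial q (x (i + 1)) (x i))
     = bailey_iterate q p n"
  using assms(1,3)
proof (induction p arbitrary: n rule: nat_induct_at_least)
  case base
  then show ?case using tuples_ending_in_1 by (simp del: bailey_iterate.simps)
next
  case (Suc p)
  let ?w = "\<lambda>p x. \<Prod>i=1..p-1. q ^ ((x i)\<^sup>2) * qbinomial q (x (i + 1)) (x i)"
  \<comment> \<open>The overwritten entry was the dummy value, so nothing is lost.\<close>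
  have inj: "inj_on (\<lambda>x. x(Suc p := n)) (tuples_ending_in p m)" for m
  proof (rule inj_onI)
    fix x y assume xy: "x \<in> tuples_ending_in p m" "y \<in> tuples_ending_in p m" "x(Suc p := n) = y(Suc p := n)"
    then have "x (Suc p) = y (Suc p)"
      by (simp add: tuples_ending_in_def monotone_tuples_def PiE_def extensional_def)
    with xy(3) show "x = y" by (metis fun_upd_triv fun_upd_upd)
  qed
  \<comment> \<open>The update leaves position p alone, and that entry identifies the slice.\<close>
  have disj: "(\<lambda>x. x(Suc p := n)) ` tuples_ending_in p i \<inter> (\<lambda>x. x(Suc p := n)) ` tuples_ending_in p j = {}"
    if "i \<noteq> j" for i j
  proof -
    have "y p = m" if "y \<in> (\<lambda>x. x(Suc p := n)) ` tuples_ending_in p m" for y m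
      using that by (auto simp: tuples_ending_in_def)
    then show ?thesis using that by blast
  qed
  have "sum (?w (Suc p)) (tuples_ending_in (Suc p) n)
      = (\<Sum>m\<le>n. sum (?w (Suc p)) ((\<lambda>x. x(Suc p := n)) ` tuples_ending_in p m))"
    unfolding tuples_ending_in_Suc[OF Suc.hyps]
    by (rule sum.UNION_disjoint) (simp_all add: finite_tuples_ending_in[OF Suc.hyps] disj)
  also have "\<dots> = (\<Sum>m\<le>n. \<Sum>x\<in>tuples_ending_in p m. ?w (Suc p) (x(Suc p := n)))"
    by (simp add: sum.reindex[OF inj])
  also have "\<dots> = (\<Sum>m\<le>n. \<Sum>x\<in>tuples_ending_in p m. q ^ m\<^sup>2 * gauss_binomial q n m * ?w p x)"
  proof (intro sum.cong refl)
    fix m x assume m: "m \<in> {..n}" and x: "x \<in> tuples_ending_in p m"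
    obtain p' where p': "p = Suc p'" using Suc.hyps by (cases p) auto
    have "gauss_binomial q n m = qbinomial q n m"
      using gauss_binomial_eq_qpoch[of m n q] qpoch_primitive_root_nonzero[OF assms(2) Suc.prems] m
      by (simp add: qbinomial_def)
    moreover have "x p = m" using x by (simp add: tuples_ending_in_def)
    moreover have "(\<Prod>i=1..p'. q ^ (((x(Suc p := n)) i)\<^sup>2) * qbinomial q ((x(Suc p := n)) (i + 1)) ((x(Suc p := n)) i))
       = (\<Prod>i=1..p'. q ^ ((x i)\<^sup>2) * qbinomial q (x (i + 1)) (x i))"
      by (intro prod.cong refl) (simp add: p')
    ultimately show "?w (Suc p) (x(Suc p := n)) = q ^ m\<^sup>2 * gauss_binomial q n m * ?w p x"
      by (simp add: p')
  qed
  also have "\<dots> = (\<Sum>m\<le>n. q ^ m\<^sup>2 * gauss_binomial q n m * bailey_iterate q p m)"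
    using Suc.IH Suc.prems by (intro sum.cong refl) (simp flip: sum_distrib_left)
  finally show ?case by simp
qed

lemma H10_eq_sum_bailey_iterate:
  assumes "1 \<le> p" "primitive_root_of_unity N q"
  shows "H10 p q = (\<Sum>n<N. q powi (- (int n)\<^sup>2) * qpoch q (q ^ n) n * bailey_iterate q p n)"
proof -
  let ?T = "\<Union>n<N. tuples_ending_in p n"
  have "H10 p q = infsum (H10_summand p q) ?T"
    unfolding H10_def
  proof (rule infsum_cong_neutral)
    fix x assume "x \<in> monotone_tuples p - ?T"
    then show "H10_summand p q x = 0"
      by (intro H10_summand_eq_0[OF assms(2)]) (auto simp: tuples_ending_in_def not_less)
  qed (auto simp: tuples_ending_in_def)
  also have "\<dots> = sum (H10_summand p q) ?T"
    using assms(1) by (intro infsum_finite) (auto simp: finite_tuples_ending_in)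
  also have "\<dots> = (\<Sum>n<N. sum (H10_summand p q) (tuples_ending_in p n))"
    by (rule sum.UNION_disjoint)
      (simp_all add: finite_tuples_ending_in[OF assms(1)], auto simp: tuples_ending_in_def)
  also have "\<dots> = (\<Sum>n<N. q powi (- (int n)\<^sup>2) * qpoch q (q ^ n) n * bailey_iterate q p n)"
  proof (rule sum.cong[OF refl])
    fix n assume "n \<in> {..<N}"
    then have n: "n < N" by simp
    have "sum (H10_summand p q) (tuples_ending_in p n) = (\<Sum>x\<in>tuples_ending_in p n. q powi (- (int n)\<^sup>2) * qpoch q (q ^ n) n *
        (\<Prod>i=1..p-1. q ^ ((x i)\<^sup>2) * qbinomial q (x (i + 1)) (x i)))"
      by (intro sum.cong refl) (simp add: H10_summand_def tuples_ending_in_def)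
    then show "sum (H10_summand p q) (tuples_ending_in p n) = q powi (- (int n)\<^sup>2) * qpoch q (q ^ n) n * bailey_iterate q p n"
      by (simp only: sum_tuples_ending_in[OF assms n] flip: sum_distrib_left)
  qed
  finally show ?thesis .
qed

section \<open>Reflection at a root of unity\<close>

lemma schur_sum_even:
  "schur_sum q (2 * m) = (\<Sum>l\<le>m. (- 1) ^ l * q ^ (l choose 2) * gauss_binomial q (2 * m - l) l)"
  unfolding schur_sum_def
proof (rule sum.mono_neutral_right)
  show "\<forall>l\<in>{..2 * m} - {..m}. (- 1) ^ l * q ^ (l choose 2) * gauss_binomial q (2 * m - l) l = 0"
  proof
    fix l assume "l \<in> {..2 * m} - {..m}"
    then have "m < l" by simp
    then have "2 * m - l < l" by linarith
    then show "(- 1) ^ l * q ^ (l choose 2) * gauss_binomial q (2 * m - l) l = 0"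
      by (simp add: gauss_binomial_eq_0)
  qed
qed auto

text \<open>Merges the two Schur sums, the second shifted by one index, into the form in which the
  reflected folded binomials appear.\<close>

lemma alpha_hat_eq_sum:
  "alpha_hat q k = (\<Sum>l\<le>k. (- 1) ^ l * q ^ (l choose 2) * (gauss_binomial q (2 * Suc k - l) l
     - (if l = 0 then 0 else q ^ (Suc k - l) * gauss_binomial q (2 * Suc k - l - 1) (l - 1))))"
proof -
  let ?h = "\<lambda>l. (- 1) ^ l * q ^ (l choose 2) * (if l = 0 then 0 else q ^ (Suc k - l) * gauss_binomial q (2 * Suc k - l - 1) (l - 1))"
  have "q ^ k * schur_sum q (2 * k) = - (\<Sum>l\<le>k. ?h (Suc l))"
    unfolding schur_sum_even sum_distrib_left sum_negf[symmetric]
  proof (rule sum.cong[OF refl])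
    fix l assume "l \<in> {..k}"
    then have "q ^ k * q ^ (l choose 2) = q ^ (Suc l choose 2) * q ^ (k - l)"
      by (simp add: choose_2_Suc add.commute flip: power_add)
    then show "q ^ k * ((- 1) ^ l * q ^ (l choose 2) * gauss_binomial q (2 * k - l) l) = - ?h (Suc l)"
      by (simp add: mult_ac)
  qed
  also have "(\<Sum>l\<le>k. ?h (Suc l)) = (\<Sum>l\<le>Suc k. ?h l)"
    by (subst sum.atMost_Suc_shift) simp
  finally have "q ^ k * schur_sum q (2 * k) = - (\<Sum>l\<le>Suc k. ?h l)" .
  moreover have "schur_sum q (2 * k + 2)
      = (\<Sum>l\<le>Suc k. (- 1) ^ l * q ^ (l choose 2) * gauss_binomial q (2 * Suc k - l) l)"
    using schur_sum_even[of q "Suc k"] by simp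
  ultimately have "alpha_hat q k = (\<Sum>l\<le>Suc k. (- 1) ^ l * q ^ (l choose 2) * gauss_binomial q (2 * Suc k - l) l - ?h l)"
    unfolding alpha_hat_eq_schur_sum by (simp only: sum_subtractf) simp
  \<comment> \<open>At l = k + 1 both Gaussian binomials are 1 and the power of q is 1, so this term
    cancels.\<close>
  also have "\<dots> = (\<Sum>l\<le>k. (- 1) ^ l * q ^ (l choose 2) * gauss_binomial q (2 * Suc k - l) l - ?h l)"
    by (simp del: power_Suc)
  finally show ?thesis by (simp only: right_diff_distrib)
qed

section \<open>Reflection of powers and Gaussian binomials\<close>

lemma primitive_root_powi_eq:
  assumes "primitive_root_of_unity N q" "int N dvd a - b"
  shows "q powi a = q powi b"
proof -
  have q: "q \<noteq> 0" "q ^ N = 1" using assms(1) by (auto simp: primitive_root_of_unity_def power_0_left)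
  obtain c where "a = b + int N * c" using assms(2) by (metis add.commute diff_add_cancel dvdE)
  then show ?thesis using q by (simp add: power_int_add power_int_mult)
qed

text \<open>For even N the power is q^(N/2) = -1 raised to the odd exponent N - 1; for odd N the
  exponent is a multiple of N.\<close>

lemma primitive_root_power_choose_2:
  assumes "primitive_root_of_unity N q"
  shows "(- 1) ^ N * q ^ (N choose 2) = -1"
proof (cases "even N")
  case True
  then obtain h where h: "N = 2 * h" by blast
  have "h > 0" using assms h by (simp add: primitive_root_of_unity_def)
  then have "q ^ h \<noteq> 1" "(q ^ h)\<^sup>2 = 1"
    using assms h by (auto simp: primitive_root_of_unity_def mult.commute simp flip: power_mult)
  then have "q ^ h = -1" by (simp add: power2_eq_1_iff)
  moreover have "N choose 2 = h * (2 * h - 1)" by (simp add: choose_two h)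
  ultimately show ?thesis using h \<open>h > 0\<close> by (simp add: power_mult)
next
  case False
  then obtain h where h: "N = 2 * h + 1" by (auto elim: oddE)
  then have "N choose 2 = N * h" by (simp add: choose_two)
  then show ?thesis using assms False by (simp add: power_mult primitive_root_of_unity_def)
qed

lemma primitive_root_powi_choose_2:
  assumes "primitive_root_of_unity N q"
  shows "q powi (- int (N choose 2)) = - ((- 1) ^ N)"
proof -
  have "q ^ (N choose 2) * - ((- 1) ^ N) = 1"
    using primitive_root_power_choose_2[OF assms] by (simp add: mult.commute)
  then show ?thesis
    unfolding power_int_minus power_int_of_nat by (rule inverse_unique)
qed

text \<open>Since q^(M+b+1) = 1, the upper entry M behaves like the negative number -b-1, and this
  is the upper negation rule. Induction compares ratios of neighbours; k < N allows division by 1 -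
  q^j for 1 <= j <= k.\<close>

lemma gauss_binomial_reflect:
  assumes "primitive_root_of_unity N q" "N dvd M + b + 1" "k < N" "k \<le> M"
  shows "gauss_binomial q M k * q ^ ((b + 1) * k + (k choose 2)) = (- 1) ^ k * gauss_binomial q (b + k) k"
  using assms(3,4)
proof (induction k)
  case (Suc k)
  have q_k: "q ^ Suc k \<noteq> 1"
    unfolding primitive_root_power_eq_1_iff[OF assms(1)] using Suc.prems by (auto dest: dvd_imp_le)
  have e1: "q ^ (b + 1 + k) * q ^ (M - k) = 1"
    using Suc.prems primitive_root_power_eq_1_iff[OF assms(1), of "M + b + 1"] assms(2)
    by (simp add: algebra_simps del: power_Suc flip: power_add)
  have e2: "q ^ ((b + 1) * Suc k + (Suc k choose 2)) = q ^ ((b + 1) * k + (k choose 2)) * q ^ (b + 1 + k)"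
    by (simp only: power_add[symmetric]) (simp add: choose_2_Suc algebra_simps)
  have e3: "gauss_binomial q M (Suc k) * (1 - q ^ Suc k) = gauss_binomial q M k * (1 - q ^ (M - k))"
    using Suc.prems by (intro gauss_binomial_Suc_right) simp
  have e4: "gauss_binomial q (b + Suc k) (Suc k) * (1 - q ^ Suc k) = gauss_binomial q (b + k) k * (1 - q ^ (b + 1 + k))"
    using gauss_binomial_absorb[of k "b + k" q] by simp
  have IH: "gauss_binomial q M k * q ^ ((b + 1) * k + (k choose 2)) = (- 1) ^ k * gauss_binomial q (b + k) k"
    using Suc.prems by (intro Suc.IH) simp_all
  \<comment> \<open>With F = q^(b+1+k) and t = q^(M-k), F t = 1 gives F (1 - t) = - (1 - F), the
    source of the sign.\<close>
  have "(1 - y) * (X' * (E * F)) = (1 - y) * (- s * Z')"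
    if "F * t = 1" "X' * (1 - y) = X * (1 - t)" "Z' * (1 - y) = Z * (1 - F)" "X * E = s * Z"
    for X X' E F t y s Z Z' :: complex
  proof -
    have "(1 - y) * (X' * (E * F)) = (X' * (1 - y)) * (E * F)" by (simp only: mult_ac)
    also have "\<dots> = (X * E) * (F - F * t)" unfolding that(2) by (simp add: algebra_simps)
    also have "\<dots> = - s * (Z * (1 - F))" unfolding that(1,4) by (simp add: algebra_simps)
    also have "\<dots> = (1 - y) * (- s * Z')" unfolding that(3)[symmetric] by (simp only: mult_ac)
    finally show ?thesis .
  qed
  note this[OF e1 e3 e4 IH]
  moreover have "1 - q ^ Suc k \<noteq> 0" using q_k by simp
  ultimately have "gauss_binomial q M (Suc k) * (q ^ ((b + 1) * k + (k choose 2)) * q ^ (b + 1 + k))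
      = - ((- 1) ^ k) * gauss_binomial q (b + Suc k) (Suc k)"
    by (rule mult_left_cancel[THEN iffD1, rotated])
  then show ?case unfolding e2 by simp
qed (simp add: binomial_eq_0)

lemma gauss_binomial_reflect_powi:
  assumes "primitive_root_of_unity N q" "N dvd M + b + 1" "k < N" "k \<le> M"
  shows "gauss_binomial q M k = (- 1) ^ k * q powi (- (int (b + 1) * int k + int (k choose 2))) * gauss_binomial q (b + k) k"
proof -
  have q: "q \<noteq> 0" using assms(1) by (auto simp: primitive_root_of_unity_def power_0_left)
  have "q powi (- (int (b + 1) * int k + int (k choose 2))) = inverse (q ^ ((b + 1) * k + (k choose 2)))"
    unfolding power_int_minus by (simp add: algebra_simps flip: power_int_of_nat)
  moreover have "q ^ ((b + 1) * k + (k choose 2)) \<noteq> 0" using q by simp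
  then have "gauss_binomial q M k = (- 1) ^ k * gauss_binomial q (b + k) k / q ^ ((b + 1) * k + (k choose 2))"
    using gauss_binomial_reflect[OF assms] by (rule nonzero_eq_divide_eq[THEN iffD2])
  ultimately show ?thesis by (simp only: divide_inverse mult_ac)
qed

text \<open>Here (N choose 2) = (r choose 2) + (m choose 2) + r m with r m = - m^2 mod N, so (r
  choose 2) is congruent to (N choose 2) + (m+1 choose 2).\<close>

lemma power_choose_2_reflect:
  assumes "primitive_root_of_unity N q" "r + m = N"
  shows "(- 1) ^ r * q ^ (r choose 2) = - ((- 1) ^ m * q powi (int (Suc m choose 2)))"
proof -
  have "2 * int (N choose 2) = 2 * (int (r choose 2) + int (m choose 2) + int r * int m)"
    unfolding double_choose_2 distrib_left by (simp add: algebra_simps flip: assms(2))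
  then have "int (r choose 2) - (int (N choose 2) + int (Suc m choose 2)) = int N * (- int m)"
    using double_choose_2[of "Suc m"] double_choose_2[of m] by (simp add: algebra_simps flip: assms(2))
  then have "q powi (int (r choose 2)) = q powi (int (N choose 2) + int (Suc m choose 2))"
    by (intro primitive_root_powi_eq[OF assms(1)]) simp
  also have "\<dots> = q ^ (N choose 2) * q powi (int (Suc m choose 2))"
    by (simp add: power_add flip: of_nat_add)
  finally have "(- 1) ^ r * q ^ (r choose 2) = ((- 1) ^ r * q ^ (N choose 2)) * q powi (int (Suc m choose 2))"
    by simp
  also have "(- 1) ^ r * q ^ (N choose 2) = (- 1) ^ m * ((- 1) ^ N * q ^ (N choose 2))"
    by (simp add: power_add mult_ac flip: assms(2))
  finally show ?thesis
    unfolding primitive_root_power_choose_2[OF assms(1)] by simp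
qed

text \<open>With i = k + 1 - l the outer index is n = N - i, so 2n - 1 acts like -(2i+1). Reflecting
  both Gaussian binomials, with lower entries l and, after symmetry, l - 1, gives upper entries
  2k+2-l and 2k+1-l. The rest compares exponents.\<close>

lemma folded_binomial_reflect:
  assumes "primitive_root_of_unity N q" "r + Suc k = N" "l \<le> k"
  shows "q powi (- (int (r + l))\<^sup>2) * ((- 1) ^ r * q ^ (r choose 2)) * folded_binomial q (r + l) r
     = (- 1) ^ k * q powi (- int (Suc k choose 2)) * ((- 1) ^ l * q ^ (l choose 2) * (gauss_binomial q (2 * Suc k - l) l
     - (if l = 0 then 0 else q ^ (Suc k - l) * gauss_binomial q (2 * Suc k - l - 1) (l - 1))))"
proof (cases "r + l = 0")
  \<comment> \<open>The conventional value 1 of \<open>folded_binomial\<close> at n = 0 is not given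
    by its two-term formula; this occurs only for k = N - 1, l = 0.\<close>
  case True
  then have "N = Suc k" "r = 0" "l = 0" using assms(2) by simp_all
  then show ?thesis using primitive_root_powi_choose_2[OF assms(1)]
    by (simp add: folded_binomial_def binomial_eq_0)
next
  case False
  have q: "q \<noteq> 0" using assms(1) by (auto simp: primitive_root_of_unity_def power_0_left)
  define i where "i = Suc k - l"
  define n where "n = r + l"
  define c where "c j = int (j choose 2)" for j
  have c2: "2 * c j = int j * (int j - 1)" for j
    unfolding c_def by (rule double_choose_2)
  have i: "int i = int k + 1 - int l" using assms(3) by (simp add: i_def)
  have n: "1 \<le> n" "int n = int N - int i" "int r = int N - int k - 1"
    using False assms(2,3) by (auto simp: n_def i_def)
  \<comment> \<open>The sum is 2N, so the reflection applies with b = 2i.\<close>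
  have dvd: "N dvd 2 * n - 1 + 2 * i + 1"
    using n assms(2,3) by (intro dvdI[of _ _ 2]) (simp add: n_def i_def)
  have A: "gauss_binomial q (2 * n - 1) (n - r)
      = (- 1) ^ l * q powi (- (int (2 * i + 1) * int l + c l)) * gauss_binomial q (2 * Suc k - l) l"
  proof -
    have "n - r = l" "2 * Suc k - l = 2 * i + l" using assms(3) by (simp_all add: n_def i_def)
    moreover have "l < N" "l \<le> 2 * n - 1" using assms(2,3) n(1) by (simp_all add: n_def)
    ultimately show ?thesis
      using gauss_binomial_reflect_powi[OF assms(1) dvd, of l] by (simp only: c_def)
  qed
  have B: "gauss_binomial q (2 * n - 1) (n + r) = (if l = 0 then 0 else
      - ((- 1) ^ l) * q powi (- (int (2 * i + 1) * (int l - 1) + c (l - 1))) * gauss_binomial q (2 * Suc k - l - 1) (l - 1))"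
  proof (cases l)
    case 0
    then show ?thesis using n(1) by (simp add: n_def gauss_binomial_eq_0)
  next
    case (Suc j)
    have "gauss_binomial q (2 * n - 1) (n + r) = gauss_binomial q (2 * n - 1) j"
    proof -
      have "n + r = 2 * n - 1 - j" "j \<le> 2 * n - 1" by (simp_all add: n_def Suc)
      then show ?thesis using gauss_binomial_symmetric[of j "2 * n - 1" q] by (simp only:)
    qed
    moreover have "2 * i + j = 2 * Suc k - l - 1" using assms(3) by (simp add: i_def Suc)
    ultimately show ?thesis
      using gauss_binomial_reflect_powi[OF assms(1) dvd, of j] assms(2,3) by (simp add: n_def c_def Suc)
  qed
  have sq: "q powi (- (int n)\<^sup>2) = q powi (- (int i)\<^sup>2)"
    by (rule primitive_root_powi_eq[OF assms(1)]) (simp add: n power2_eq_square algebra_simps)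
  have qr: "q ^ r = q powi (- int (Suc k))"
    unfolding power_int_of_nat[symmetric]
    by (rule primitive_root_powi_eq[OF assms(1)]) (simp add: n)
  have S: "(- 1) ^ r * q ^ (r choose 2) = (- 1) ^ k * q powi (c (Suc (Suc k)))"
    using power_choose_2_reflect[OF assms(1,2)] by (simp add: c_def)
  have 1: "q powi (- (int i)\<^sup>2) * q powi (c (Suc (Suc k))) * q powi (- (int (2 * i + 1) * int l + c l))
      = q powi (- c (Suc k)) * q ^ (l choose 2)"
  proof -
    \<comment> \<open>Doubling turns the triangular exponents into polynomials via
      \<open>double_choose_2\<close>.\<close>
    have "2 * (- (int i)\<^sup>2 + c (Suc (Suc k)) - (int (2 * i + 1) * int l + c l)) = 2 * (- c (Suc k) + c l)"
      unfolding right_diff_distrib distrib_left mult_minus_right c2 by (simp add: i power2_eq_square algebra_simps)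
    then have "- (int i)\<^sup>2 + c (Suc (Suc k)) + - (int (2 * i + 1) * int l + c l) = - c (Suc k) + c l"
      by (subst (asm) mult_cancel_left) simp
    from arg_cong[OF this, of "(powi) q"] show ?thesis
      by (simp only: power_int_add[OF disjI1[OF q]] c_def power_int_of_nat)
  qed
  have 2: "q powi (- (int i)\<^sup>2) * q powi (c (Suc (Suc k))) * q powi (- int (Suc k)) * q powi (- (int (2 * i + 1) * (int l - 1) + c (l - 1)))
      = q powi (- c (Suc k)) * q ^ (l choose 2) * q ^ i" if "l \<noteq> 0"
  proof -
    have "2 * (- (int i)\<^sup>2 + c (Suc (Suc k)) - int (Suc k) - (int (2 * i + 1) * (int l - 1) + c (l - 1))) = 2 * (- c (Suc k) + c l + int i)"
      unfolding right_diff_distrib distrib_left mult_minus_right c2 using that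
      by (simp add: i power2_eq_square of_nat_diff algebra_simps)
    then have "- (int i)\<^sup>2 + c (Suc (Suc k)) + - int (Suc k) + - (int (2 * i + 1) * (int l - 1) + c (l - 1)) = - c (Suc k) + c l + int i"
      by (subst (asm) mult_cancel_left) simp
    from arg_cong[OF this, of "(powi) q"] show ?thesis
      by (simp only: power_int_add[OF disjI1[OF q]] c_def power_int_of_nat)
  qed
  have "q powi (- (int n)\<^sup>2) * ((- 1) ^ r * q ^ (r choose 2)) * folded_binomial q n r
     = (- 1) ^ k * (- 1) ^ l * ((q powi (- (int i)\<^sup>2) * q powi (c (Suc (Suc k))) * q powi (- (int (2 * i + 1) * int l + c l))) * gauss_binomial q (2 * Suc k - l) l
       - (if l = 0 then 0 else (q powi (- (int i)\<^sup>2) * q powi (c (Suc (Suc k))) * q powi (- int (Suc k)) * q powi (- (int (2 * i + 1) * (int l - 1) + c (l - 1)))) * gauss_binomial q (2 * Suc k - l - 1) (l - 1)))"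
    using n(1) unfolding folded_binomial_def A B sq S qr by (simp add: distrib_left right_diff_distrib mult_ac)
  also have "\<dots> = (- 1) ^ k * (- 1) ^ l * ((q powi (- c (Suc k)) * q ^ (l choose 2)) * gauss_binomial q (2 * Suc k - l) l
       - (if l = 0 then 0 else (q powi (- c (Suc k)) * q ^ (l choose 2) * q ^ i) * gauss_binomial q (2 * Suc k - l - 1) (l - 1)))"
    using 1 2 by simp
  finally show ?thesis unfolding n_def i_def c_def by (simp add: right_diff_distrib mult_ac)
qed

section \<open>Column sums and the final evaluation\<close>

lemma sum_folded_binomial_column:
  assumes "primitive_root_of_unity N q" "r + Suc k = N"
  shows "(\<Sum>n=r..<N. q powi (- (int n)\<^sup>2) * ((- 1) ^ r * q ^ (r choose 2)) * folded_binomial q n r)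
     = (- 1) ^ k * q powi (- int (Suc k choose 2)) * alpha_hat q k"
proof -
  have "(\<Sum>n=r..<N. q powi (- (int n)\<^sup>2) * ((- 1) ^ r * q ^ (r choose 2)) * folded_binomial q n r)
    = (\<Sum>l\<le>k. q powi (- (int (r + l))\<^sup>2) * ((- 1) ^ r * q ^ (r choose 2)) * folded_binomial q (r + l) r)"
    by (rule sum.reindex_bij_witness[of _ "\<lambda>l. r + l" "\<lambda>n. n - r"]) (use assms(2) in auto)
  also have "\<dots> = (- 1) ^ k * q powi (- int (Suc k choose 2)) * alpha_hat q k"
    unfolding alpha_hat_eq_sum sum_distrib_left
    by (intro sum.cong refl folded_binomial_reflect[OF assms]) simp
  finally show ?thesis .
qed

theorem theorem2p16:
  fixes p N :: nat and q :: complex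
  assumes "p \<ge> 1" and "N \<ge> 1" and "primitive_root_of_unity N q"
  shows "- (1 / 2) + H10 p q =
    q ^ p * ((\<Sum>k<N - 1. (- 1) ^ k * q powi (- int ((k + 1) choose 2) + int p * ((int k)\<^sup>2 + 2 * int k)) * alpha_hat q k)
      + 1 / 2 * q powi (- int p) * alpha_hat q (N - 1))"
proof -
  note root = assms(3)
  have q: "q \<noteq> 0" "q ^ N = 1" using root by (auto simp: primitive_root_of_unity_def power_0_left)
  have norm_q: "norm q \<le> 1"
  proof -
    have "norm q ^ N = 1" using q(2) by (simp flip: norm_power)
    then show ?thesis using one_less_power[of "norm q" N] assms(2) by (force simp: not_le)
  qed
  let ?c = "\<lambda>n r. q powi (- (int n)\<^sup>2) * ((- 1) ^ r * q ^ (r choose 2)) * folded_binomial q n r"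
  let ?b = "\<lambda>k. (- 1) ^ k * q powi (- int (Suc k choose 2)) * alpha_hat q k"
  \<comment> \<open>The -1/2 is moved into the term n = 0, whose value 1 becomes 1/2, exactly the
    weight \<open>half_at_0 0\<close> on the folded side.\<close>
  have "- (1 / 2) + H10 p q = (\<Sum>n<N. q powi (- (int n)\<^sup>2) * qpoch q (q ^ n) n * bailey_iterate q p n - (if n = 0 then 1 / 2 else 0))"
    using assms(2) unfolding H10_eq_sum_bailey_iterate[OF assms(1) root] sum_subtractf by (simp add: sum.delta)
  also have "\<dots> = (\<Sum>n<N. \<Sum>r\<le>n. half_at_0 r * q ^ (p * r\<^sup>2) * ?c n r)"
  proof (rule sum.cong[OF refl])
    fix n
    show "q powi (- (int n)\<^sup>2) * qpoch q (q ^ n) n * bailey_iterate q p n - (if n = 0 then 1 / 2 else 0)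
       = (\<Sum>r\<le>n. half_at_0 r * q ^ (p * r\<^sup>2) * ?c n r)"
    proof (cases "n = 0")
      case True
      have "bailey_iterate q (Suc j) 0 = 1" for j by (induction j) simp_all
      then have "bailey_iterate q p 0 = 1" using assms(1) by (cases p) simp_all
      then show ?thesis using True by (simp add: half_at_0_def folded_binomial_def binomial_eq_0)
    next
      case False
      then show ?thesis
        using bailey_iterate_eq_folded_sum[OF norm_q, of n p]
        by (simp add: mult.assoc sum_distrib_left power_add) (simp add: mult_ac)
    qed
  qed
  also have "\<dots> = (\<Sum>r<N. \<Sum>n=r..<N. half_at_0 r * q ^ (p * r\<^sup>2) * ?c n r)"
    by (simp add: sum.Sigma) (rule sum.reindex_bij_witness[of _ prod.swap prod.swap], auto)
  also have "\<dots> = (\<Sum>r<N. half_at_0 r * q ^ (p * r\<^sup>2) * ?b (N - Suc r))"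
    unfolding sum_distrib_left[symmetric]
    by (intro sum.cong refl arg_cong2[of _ _ _ _ "(*)"] sum_folded_binomial_column[OF root]) simp
  also have "\<dots> = (\<Sum>k<N. half_at_0 (N - Suc k) * q ^ (p * (N - Suc k)\<^sup>2) * ?b k)"
    by (subst sum.nat_diff_reindex[symmetric]) (intro sum.cong refl, simp)
  \<comment> \<open>With r = N - (k+1), r^2 is congruent to (k+1)^2 mod N, so the chain exponent
    survives the reflection.\<close>
  also have "\<dots> = (\<Sum>k<N. half_at_0 (N - Suc k) * q powi (int p * (int (Suc k))\<^sup>2) * ?b k)"
  proof (intro sum.cong refl arg_cong2[of _ _ _ _ "(*)"])
    fix k assume "k \<in> {..<N}"
    then have "int (N - Suc k) = int N - int (Suc k)" by simp
    then have "q powi int (p * (N - Suc k)\<^sup>2) = q powi (int p * (int (Suc k))\<^sup>2)"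
      by (intro primitive_root_powi_eq[OF root] dvdI[of _ _ "int p * (int N - 2 * int (Suc k))"])
        (simp only: of_nat_mult of_nat_power, simp add: power2_eq_square algebra_simps)
    then show "q ^ (p * (N - Suc k)\<^sup>2) = q powi (int p * (int (Suc k))\<^sup>2)"
      by (simp only: power_int_of_nat)
  qed
  \<comment> \<open>The weight 1/2 at r = 0 now sits at k = N - 1, which yields the separate halved
    term.\<close>
  also have "\<dots> = (\<Sum>k<N - 1. half_at_0 (N - Suc k) * q powi (int p * (int (Suc k))\<^sup>2) * ?b k)
      + 1 / 2 * q powi (int p * (int N)\<^sup>2) * ?b (N - 1)"
    using assms(2) by (cases N) (simp_all add: half_at_0_def)
  also have "q powi (int p * (int N)\<^sup>2) = 1"
    using primitive_root_powi_eq[OF root, of "int p * (int N)\<^sup>2" 0] by (simp add: power2_eq_square)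
  also have "?b (N - 1) = alpha_hat q (N - 1)"
    using primitive_root_powi_choose_2[OF root] assms(2) by (cases N) simp_all
  also have "(\<Sum>k<N - 1. half_at_0 (N - Suc k) * q powi (int p * (int (Suc k))\<^sup>2) * ?b k)
    = q ^ p * (\<Sum>k<N - 1. (- 1) ^ k * q powi (- int ((k + 1) choose 2) + int p * ((int k)\<^sup>2 + 2 * int k)) * alpha_hat q k)"
    unfolding sum_distrib_left
  proof (rule sum.cong[OF refl])
    fix k assume "k \<in> {..<N - 1}"
    then have "half_at_0 (N - Suc k) = 1" by (simp add: half_at_0_def)
    \<comment> \<open>Writing (k+1)^2 = 1 + (k^2 + 2k) extracts the prefactor q^p.\<close>
    moreover have e: "int p * (int (Suc k))\<^sup>2 = int p + int p * ((int k)\<^sup>2 + 2 * int k)"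
      by (simp add: power2_eq_square algebra_simps)
    ultimately show "half_at_0 (N - Suc k) * q powi (int p * (int (Suc k))\<^sup>2) * ?b k
      = q ^ p * ((- 1) ^ k * q powi (- int ((k + 1) choose 2) + int p * ((int k)\<^sup>2 + 2 * int k)) * alpha_hat q k)"
      unfolding e power_int_add[OF disjI1[OF q(1)]] by (simp add: mult_ac)
  qed
  finally show ?thesis
    using q(1) by (simp add: distrib_left power_int_minus)
qed

end
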